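(* If a poset $P$ has a $(2^{\aleph_0})^+$-lifter, then $P$ is well-founded.
   Context: All posets are nonempty. A poset is well-founded if each nonempty subset has a minimal element. $[X]^{<\kappa}$ is the set of subsets of $X$ of cardinality $<\kappa$; $\kappa^+$ is the successor cardinal of $\kappa$. A poset $X$ is a *pseudo join-semilattice* if for every $Y\subseteq X$ that is empty or has two elements, the set of upper bounds of $Y$ in $X$ equals $\{x\mid(\exists f\in F)(f\le x)\}$ for some finite $F\subseteq X$. An *ideal* of a poset is a nonempty directed lower subset. A *norm-covering* of $P$ is a pseudo join-semilattice $X$ with an isotone map $\partial\colon X\to P$. An ideal $\mathbf{u}$ of $X$ is sharp if $\{\partial x\mid x\in\mathbf{u}\}$ has a largest element, denoted $\partial\mathbf{u}$. For an uncountable cardinal $\lambda$, a *$\lambda$-lifter* of $P$ is a pair $(X,\mathbf{X})$ with $X$ a norm-covering of $P$ and $\mathbf{X}$ a set of sharp ideals of $X$ (ordered by inclusion) such that, with $\mathbf{X}^{=}=\{\mathbf{x}\in\mathbf{X}\mid\partial\mathbf{x}\text{ not maximal in }P\}$: (1) $\mathrm{card}\{\mathbf{y}\in\mathbf{X}\mid\mathbf{y}\subseteq\mathbf{x}\}<\mathrm{cf}(\lambda)$ for each $\mathbf{x}\in\mathbf{X}^{=}$; (2) for each map $S\colon\mathbf{X}^{=}\to[X]^{<\lambda}$ there is an isotone $\sigma\colon P\to\mathbf{X}$ with $\partial\sigma(p)=p$ for all $p\in P$ and $S(\sigma(a))\cap\sigma(b)\subseteq\sigma(a)$ for all $a<b$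 in $P$. *)

theory Defs
  imports Main
begin

unbundle cardinal_syntax

text \<open>
  Posets are types of class \<open>order\<close>; since types are inhabited, they are nonempty.
  Cardinals are the cardinal orders of the BNF cardinal library.
\<close>

definition pseudo_join_semilattice :: "'x::order itself \<Rightarrow> bool" where
  "pseudo_join_semilattice _ \<longleftrightarrow>
     (\<forall>Y::'x set. Y = {} \<or> card Y = 2 \<longrightarrow>
        (\<exists>F. finite F \<and> {x. \<forall>y\<in>Y. y \<le> x} = {x. \<exists>f\<in>F. f \<le> x}))"

definition poset_ideal :: "'x::order set \<Rightarrow> bool" where
  "poset_ideal u \<longleftrightarrow>
     u \<noteq> {} \<and>
     (\<forall>x\<in>u. \<forall>y\<in>u. \<exists>z\<in>u. x \<le> z \<and> y \<le> z) \<and>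
     (\<forall>x\<in>u. \<forall>y. y \<le> x \<longrightarrow> y \<in> u)"

definition norm_covering :: "('x::order \<Rightarrow> 'p::order) \<Rightarrow> bool" where
  "norm_covering \<delta> \<longleftrightarrow> pseudo_join_semilattice TYPE('x) \<and> mono \<delta>"

definition sharp_ideal :: "('x::order \<Rightarrow> 'p::order) \<Rightarrow> 'x set \<Rightarrow> bool" where
  "sharp_ideal \<delta> u \<longleftrightarrow> poset_ideal u \<and> (\<exists>m \<in> \<delta> ` u. \<forall>p \<in> \<delta> ` u. p \<le> m)"

text \<open>The value \<open>\<delta>u\<close>, meaningful only for a sharp ideal \<open>u\<close>.\<close>

definition ideal_norm :: "('x::order \<Rightarrow> 'p::order) \<Rightarrow> 'x set \<Rightarrow> 'p" where
  "ideal_norm \<delta> u = (GREATEST p. p \<in> \<delta> ` u)"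

definition nonmax_ideals :: "('x::order \<Rightarrow> 'p::order) \<Rightarrow> 'x set set \<Rightarrow> 'x set set" where
  "nonmax_ideals \<delta> \<X> = {x \<in> \<X>. \<exists>q. ideal_norm \<delta> x < q}"

text \<open>
  The cofinality of an infinite cardinal \<open>\<kappa>\<close>: the least cardinality of a cofinal subset.
  The predicate \<^const>\<open>cofinal\<close> asks for strict upper bounds, which makes no difference
  for an order without a largest element.
\<close>

definition cofinality :: "'k rel \<Rightarrow> 'k rel" where
  "cofinality \<kappa> =
     |SOME K. K \<subseteq> Field \<kappa> \<and> cofinal K \<kappa> \<and>
        (\<forall>L. L \<subseteq> Field \<kappa> \<and> cofinal L \<kappa> \<longrightarrow> |K| \<le>o |L| )|"

definition lifter :: "'k rel \<Rightarrow> ('x::order \<Rightarrow> 'p::order) \<Rightarrow> 'x set set \<Rightarrow> bool" where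
  "lifter \<kappa> \<delta> \<X> \<longleftrightarrow>
     Card_order \<kappa> \<and> natLeq <o \<kappa> \<and>
     norm_covering \<delta> \<and>
     (\<forall>x\<in>\<X>. sharp_ideal \<delta> x) \<and>
     (\<forall>x \<in> nonmax_ideals \<delta> \<X>. |{y \<in> \<X>. y \<subseteq> x}| <o cofinality \<kappa>) \<and>
     (\<forall>S :: 'x set \<Rightarrow> 'x set. (\<forall>x \<in> nonmax_ideals \<delta> \<X>. |S x| <o \<kappa>) \<longrightarrow>
        (\<exists>\<sigma> :: 'p \<Rightarrow> 'x set.
           range \<sigma> \<subseteq> \<X> \<and> mono \<sigma> \<and>
           (\<forall>p. ideal_norm \<delta> (\<sigma> p) = p) \<and>
           (\<forall>a b. a < b \<longrightarrow> S (\<sigma> a) \<inter> \<sigma> b \<subseteq> \<sigma> a)))"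

definition continuum :: "(nat \<Rightarrow> bool) rel" where
  "continuum = BNF_Cardinal_Arithmetic.cexp BNF_Cardinal_Arithmetic.ctwo natLeq"

end

(* Along an infinite strictly decreasing sequence p of the poset, a map sigma as in the definition
   of a lifter yields a strictly decreasing sequence of ideals x n = sigma (p n).  Fix, by choice,
   a representative of each class of sequences modulo eventual equality.  From x n alone one sees
   only continuum many sequences of ideals below x n, but one of them is eventually equal to the
   whole sequence x, hence has the same representative r.  So let S y collect a point of
   r m - r (m + 1) for every m and every representative r of a sequence of ideals below y.  If r and
   x agree from N on, then S (x (N + 1)) meets x N - x (N + 1), a contradiction. *)

theory Submission
  imports Defs "HOL-Library.Nat_Bijection"
begin

lemma continuum_eq_card_of_UNIV: "continuum = |UNIV :: (nat \<Rightarrow> bool) set|"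
  by (simp add: continuum_def BNF_Cardinal_Arithmetic.cexp_def BNF_Cardinal_Arithmetic.ctwo_def
      Field_card_of Field_natLeq Func_def)

text \<open>The whole field is cofinal because an infinite cardinal has no largest element. A
  cofinal set of least cardinality exists because cardinals are well-ordered, so the
  \<open>SOME\<close> in \<open>cofinality\<close> does pick one.\<close>

lemma cofinality_ordLeq:
  assumes "Card_order \<kappa>" "infinite (Field \<kappa>)"
  shows "cofinality \<kappa> \<le>o \<kappa>"
proof -
  let ?C = "{K. K \<subseteq> Field \<kappa> \<and> cofinal K \<kappa>}"
  have "cofinal (Field \<kappa>) \<kappa>"
    unfolding cofinal_def using infinite_Card_order_limit[OF assms] by blast
  then have "(\<lambda>K. |K| ) ` ?C \<noteq> {}" by blast
  moreover have "\<forall>r \<in> (\<lambda>K. |K| ) ` ?C. Card_order r"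
    using card_of_Card_order by blast
  ultimately have "\<exists>r \<in> (\<lambda>K. |K| ) ` ?C. \<forall>r' \<in> (\<lambda>K. |K| ) ` ?C. r \<le>o r'"
    by (rule exists_minim_Card_order)
  then have "\<exists>K. K \<subseteq> Field \<kappa> \<and> cofinal K \<kappa> \<and>
        (\<forall>L. L \<subseteq> Field \<kappa> \<and> cofinal L \<kappa> \<longrightarrow> |K| \<le>o |L| )"
    by blast
  from someI_ex[OF this] have "cofinality \<kappa> \<le>o |Field \<kappa>|"
    unfolding cofinality_def by (intro card_of_mono1) blast
  then show ?thesis
    using card_of_Field_ordIso[OF assms(1)] ordLeq_ordIso_trans by blast
qed

text \<open>Since aleph_0 * aleph_0 = aleph_0, a pairing function packs a sequence of binary
  sequences into a single one; \<open>g\<close> decodes its k-th row to the k-th term.\<close>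

lemma card_of_sequences_ordLeq_continuum:
  assumes "|D| \<le>o |UNIV :: (nat \<Rightarrow> bool) set|"
  shows "|{s :: nat \<Rightarrow> 'a. range s \<subseteq> D}| \<le>o |UNIV :: (nat \<Rightarrow> bool) set|"
proof (cases "D = {}")
  case True
  then have "{s :: nat \<Rightarrow> 'a. range s \<subseteq> D} = {}" by auto
  then show ?thesis by (simp only: card_of_empty)
next
  case False
  then obtain g :: "(nat \<Rightarrow> bool) \<Rightarrow> 'a" where g: "range g = D"
    using card_of_ordLeq2[THEN iffD2, OF _ assms] by blast
  have "{s. range s \<subseteq> D} \<subseteq> range (\<lambda>t k. g (\<lambda>j. t (prod_encode (k, j))))"
  proof
    fix s :: "nat \<Rightarrow> 'a"
    assume "s \<in> {s. range s \<subseteq> D}"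
    then have "\<forall>k. \<exists>u. s k = g u" unfolding g[symmetric] by blast
    then obtain u where "\<forall>k. s k = g (u k)" by metis
    then have "s = (\<lambda>k. g (\<lambda>j. case_prod u (prod_decode (prod_encode (k, j)))))"
      by (intro ext) simp
    then show "s \<in> range (\<lambda>t k. g (\<lambda>j. t (prod_encode (k, j))))"
      by (intro range_eqI[of _ _ "\<lambda>i. case_prod u (prod_decode i)"])
  qed
  then show ?thesis
    by (rule surj_imp_ordLeq)
qed

definition tail_representative :: "(nat \<Rightarrow> 'a) \<Rightarrow> nat \<Rightarrow> 'a" where
  "tail_representative s = (SOME r. \<exists>N. \<forall>k\<ge>N. r k = s k)"

lemma tail_representative_eventually_eq: "\<exists>N. \<forall>k\<ge>N. tail_representative s k = s k"
  unfolding tail_representative_def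
  by (rule someI_ex[of "\<lambda>r. \<exists>N. \<forall>k\<ge>N. r k = s k"]) blast

text \<open>Eventually equal sequences put the same predicate under \<open>SOME\<close>, so the
  choices coincide everywhere, not just eventually.\<close>

lemma tail_representative_cong:
  assumes "\<And>k. k \<ge> N \<Longrightarrow> s k = s' k"
  shows "tail_representative s = tail_representative s'"
proof -
  have "eventually (\<lambda>k. r k = s k) sequentially \<longleftrightarrow> eventually (\<lambda>k. r k = s' k) sequentially" for r
    using eventually_ge_at_top[of N] by (rule eventually_cong) (simp add: assms)
  then show ?thesis
    unfolding tail_representative_def eventually_sequentially by simp
qed

text \<open>If a difference is empty, \<open>SOME\<close> adds an arbitrary point; this is harmless,
  as it does not affect the cardinality bound.\<close>

definition tail_gaps :: "'a set set \<Rightarrow> 'a set" where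
  "tail_gaps D = (\<Union>m. (\<lambda>s. SOME c. c \<in> tail_representative s m - tail_representative s (Suc m))
                       ` {s. range s \<subseteq> D})"

lemma card_of_tail_gaps:
  assumes "|D| \<le>o |UNIV :: (nat \<Rightarrow> bool) set|"
  shows "|tail_gaps D| \<le>o |UNIV :: (nat \<Rightarrow> bool) set|"
  unfolding tail_gaps_def
proof (rule card_of_UNION_ordLeq_infinite)
  have "inj (\<lambda>n i. i = (n :: nat))"
    by (rule injI) metis
  then show le: "|UNIV :: nat set| \<le>o |UNIV :: (nat \<Rightarrow> bool) set|"
    by (rule card_of_ordLeqI) (rule UNIV_I)
  from card_of_ordLeq_infinite[OF le infinite_UNIV_nat]
  show "infinite (UNIV :: (nat \<Rightarrow> bool) set)" .
qed (intro ballI ordLeq_transitive[OF card_of_image card_of_sequences_ordLeq_continuum[OF assms]])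

lemma tail_gaps_meet_difference:
  fixes x :: "nat \<Rightarrow> 'a set"
  assumes "\<And>n. x (Suc n) \<subset> x n"
  shows "\<exists>n. tail_gaps {y \<in> range x. y \<subseteq> x (Suc n)} \<inter> (x n - x (Suc n)) \<noteq> {}"
proof -
  let ?r = "tail_representative x"
  obtain N where N: "\<forall>k\<ge>N. ?r k = x k"
    using tail_representative_eventually_eq by blast
  \<comment> \<open>Freezing the initial terms at \<open>x (Suc N)\<close> puts the whole sequence
    below \<open>x (Suc N)\<close> and keeps the tail of \<open>x\<close>.\<close>
  let ?s = "\<lambda>k. x (max k (Suc N))"
  let ?c = "SOME c. c \<in> ?r N - ?r (Suc N)"
  have "x k \<subseteq> x (Suc N)" if "Suc N \<le> k" for k
    using that psubset_imp_subset[OF assms] by (rule lift_Suc_antimono_le[of x, rotated])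
  then have "range ?s \<subseteq> {y \<in> range x. y \<subseteq> x (Suc N)}"
    by (intro image_subsetI CollectI conjI rangeI) simp
  moreover have "tail_representative ?s = ?r"
    by (rule tail_representative_cong[of "Suc N"]) (simp add: max_absorb1)
  ultimately have "?c \<in> tail_gaps {y \<in> range x. y \<subseteq> x (Suc N)}"
    unfolding tail_gaps_def by (intro UN_I[of N] image_eqI[of _ _ ?s]) auto
  moreover have "?c \<in> ?r N - ?r (Suc N)"
    \<comment> \<open>The representative agrees with \<open>x\<close> at both \<open>N\<close> and
      \<open>Suc N\<close>, so this difference is \<open>x N - x (Suc N)\<close>, nonempty by
      strictness.\<close>
    by (rule someI_ex) (use N assms[of N] in auto)
  ultimately show ?thesis
    using N by auto
qed

lemma tail_gaps_mono: "D \<subseteq> E \<Longrightarrow> tail_gaps D \<subseteq> tail_gaps E"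
  unfolding tail_gaps_def by blast

theorem mainTheorem12:
  fixes \<delta> :: "'x::order \<Rightarrow> 'p::order"
    and \<X> :: "'x set set"
  assumes "lifter (cardSuc continuum) \<delta> \<X>"
  shows "wfp ((<) :: 'p \<Rightarrow> 'p \<Rightarrow> bool)"
proof (rule ccontr)
  assume "\<not> wfp ((<) :: 'p \<Rightarrow> 'p \<Rightarrow> bool)"
  then obtain p :: "nat \<Rightarrow> 'p" where p: "\<And>n. p (Suc n) < p n"
    unfolding wfp_def wf_iff_no_infinite_down_chain by auto
  let ?\<kappa> = "cardSuc continuum"
  let ?S = "\<lambda>x. tail_gaps {y \<in> \<X>. y \<subseteq> x}"
  have co: "Card_order continuum"
    by (simp add: continuum_eq_card_of_UNIV card_of_Card_order)
  have \<kappa>: "Card_order ?\<kappa>" "natLeq <o ?\<kappa>"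
    and down: "\<forall>x \<in> nonmax_ideals \<delta> \<X>. |{y \<in> \<X>. y \<subseteq> x}| <o cofinality ?\<kappa>"
    and lift: "\<forall>S. (\<forall>x \<in> nonmax_ideals \<delta> \<X>. |S x| <o ?\<kappa>) \<longrightarrow>
        (\<exists>\<sigma>. range \<sigma> \<subseteq> \<X> \<and> mono \<sigma> \<and> (\<forall>p. ideal_norm \<delta> (\<sigma> p) = p) \<and>
           (\<forall>a b. a < b \<longrightarrow> S (\<sigma> a) \<inter> \<sigma> b \<subseteq> \<sigma> a))"
    using assms unfolding lifter_def by - (elim conjE, assumption)+
  have "natLeq \<le>o |Field ?\<kappa>|"
    by (rule ordLeq_ordIso_trans[OF ordLess_imp_ordLeq[OF \<kappa>(2)]
          ordIso_symmetric[OF card_of_Field_ordIso[OF \<kappa>(1)]]])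
  then have "infinite (Field ?\<kappa>)"
    using infinite_iff_natLeq_ordLeq by metis
  then have "cofinality ?\<kappa> \<le>o ?\<kappa>"
    by (rule cofinality_ordLeq[OF \<kappa>(1)])
  have "|?S x| <o ?\<kappa>" if "x \<in> nonmax_ideals \<delta> \<X>" for x
  proof -
    \<comment> \<open>Below a successor cardinal means at most its predecessor.\<close>
    have "|{y \<in> \<X>. y \<subseteq> x}| \<le>o continuum"
      using ordLess_ordLeq_trans[OF bspec[OF down that] \<open>cofinality ?\<kappa> \<le>o ?\<kappa>\<close>]
      by (simp only: cardSuc_ordLeq_ordLess[OF co card_of_Card_order])
    then have "|?S x| \<le>o continuum"
      unfolding continuum_eq_card_of_UNIV by (rule card_of_tail_gaps)
    then show ?thesis
      by (simp only: cardSuc_ordLeq_ordLess[OF co card_of_Card_order])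
  qed
  then have "\<forall>x \<in> nonmax_ideals \<delta> \<X>. |?S x| <o ?\<kappa>"
    by (rule ballI)
  from lift[THEN spec, of ?S, THEN mp, OF this]
  obtain \<sigma> :: "'p \<Rightarrow> 'x set" where \<sigma>: "range \<sigma> \<subseteq> \<X>" "mono \<sigma>"
      "\<forall>q. ideal_norm \<delta> (\<sigma> q) = q"
      "\<forall>a b. a < b \<longrightarrow> ?S (\<sigma> a) \<inter> \<sigma> b \<subseteq> \<sigma> a"
    by (elim exE conjE)
  have "\<sigma> (p (Suc n)) \<subset> \<sigma> (p n)" for n
  proof
    show "\<sigma> (p (Suc n)) \<subseteq> \<sigma> (p n)"
      using \<sigma>(2) less_imp_le[OF p] by (rule monoD)
    \<comment> \<open>The norm is a left inverse of \<open>\<sigma>\<close>, which is therefore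
      injective.\<close>
    show "\<sigma> (p (Suc n)) \<noteq> \<sigma> (p n)"
      using less_imp_neq[OF p[of n]] \<sigma>(3) by metis
  qed
  from tail_gaps_meet_difference[of "\<lambda>n. \<sigma> (p n)", OF this]
  obtain n c where c: "c \<in> tail_gaps {y \<in> range (\<lambda>n. \<sigma> (p n)). y \<subseteq> \<sigma> (p (Suc n))}"
      "c \<in> \<sigma> (p n)" "c \<notin> \<sigma> (p (Suc n))"
    unfolding disjoint_iff by blast
  have "c \<in> ?S (\<sigma> (p (Suc n)))"
    using c(1) by (rule subsetD[OF tail_gaps_mono, rotated]) (use \<sigma>(1) in auto)
  \<comment> \<open>The lifting condition is applied with \<open>a = p (Suc n)\<close> and
    \<open>b = p n\<close>.\<close>
  then show False
    using c(2,3) \<sigma>(4)[THEN spec, THEN spec, THEN mp, OF p[of n]] by blast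
qed

end
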